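(* Let $V$ and $W$ be two wedges forming a special pair, and let $k,l\ge 1$ be integers. Then there is a finite planar point set $S$ of cardinality $\binom{k+l}{k}-1$ such that for every coloring of $S$ with red and blue, either some translate of $V$ contains $k$ red points of $S$ and no blue point, or some translate of $W$ contains $l$ blue points of $S$ and no red point.
   Context: A wedge is the region bounded by two halflines with a common endpoint (the apex). Two wedges $V,W$, both of angle less than $\pi$, form a special pair if, after translating both apices to the origin and rotating so that $W$ contains the positive $x$-axis, and letting the two lines extending the boundary halflines of $W$ divide the plane into Right $(=W)$, Left (opposite to $W$), Upper and Lower, for some labeling of the two wedges one of the following holds: (i) one boundary halfline of $V$ lies in Right and the other in Upper or Lower; (ii) both boundary halflines of $V$ lie in Upper; (iii) both lie in Lower. (Equivalently, their union lies in an open halfplane whose boundary passes through the apex, but neither contains the other.) *)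

theory Defs
  imports "HOL-Analysis.Analysis"
begin

text \<open>The Euclidean plane is identified with the type of complex numbers, so that the rotation
  about the origin by the angle \<open>\<rho>\<close> is multiplication by \<open>cis \<rho>\<close>.\<close>

text \<open>The closed wedge with apex \<open>p\<close> and boundary halflines in the directions \<open>\<alpha>\<close> and \<open>\<alpha> + \<theta>\<close>;
  its angle, measured inside the wedge, is \<open>\<theta>\<close>. It is meant for \<open>0 < \<theta> < 2 * pi\<close>.\<close>

definition wedge :: "complex \<Rightarrow> real \<Rightarrow> real \<Rightarrow> complex set" where
  "wedge p \<alpha> \<theta> = {p + of_real r * cis t | r t. 0 \<le> r \<and> \<alpha> \<le> t \<and> t \<le> \<alpha> + \<theta>}"

text \<open>The halfline from the origin in the direction \<open>t\<close>, without its endpoint: the origin lies on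
  both lines that cut the plane into Right, Left, Upper and Lower, and it is ignored
  when a boundary halfline is said to lie in one of these regions.\<close>

definition halfline :: "real \<Rightarrow> complex set" where
  "halfline t = {of_real r * cis t | r. 0 < r}"

text \<open>The lines through the boundary halflines of \<open>wedge 0 \<beta> \<phi>\<close>, where \<open>0 < \<phi> < pi\<close>, contain the
  directions \<open>\<beta>\<close>, \<open>\<beta> + \<phi>\<close>, \<open>\<beta> + pi\<close> and \<open>\<beta> + \<phi> + pi\<close>. Right and Left are the closed sectors
  \<open>wedge 0 \<beta> \<phi>\<close> and \<open>wedge 0 (\<beta> + pi) \<phi>\<close>; Upper and Lower are the remaining two open sectors.
  When the wedge contains the positive real axis, Upper is the one that is reached
  from Right counterclockwise.\<close>

definition upper_sector :: "real \<Rightarrow> real \<Rightarrow> complex set" where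
  "upper_sector \<beta> \<phi> = (\<Union>t\<in>{\<beta> + \<phi><..<\<beta> + pi}. halfline t)"

definition lower_sector :: "real \<Rightarrow> real \<Rightarrow> complex set" where
  "lower_sector \<beta> \<phi> = (\<Union>t\<in>{\<beta> + \<phi> - pi<..<\<beta>}. halfline t)"

text \<open>The three alternatives for one fixed labeling. Here \<open>V0\<close> and \<open>W0\<close> are the wedges after
  translating the apices \<open>p\<close>, \<open>q\<close> to the origin and rotating both by \<open>\<rho>\<close>.

  The condition that neither of \<open>V0\<close>, \<open>W0\<close> contains the other matters only for wedges with a
  common boundary halfline. As Right is the closed wedge \<open>W0\<close>, alternative (i) alone would
  admit a wedge \<open>V0\<close> that contains \<open>W0\<close> and shares its lower boundary halfline (when the
  other boundary halfline of \<open>V0\<close> is in Upper). With the condition, being a special pair is the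
  same as: the union of \<open>V0\<close> and \<open>W0\<close> without the apex lies in an open halfplane whose boundary
  passes through the apex, and neither contains the other. In particular, two wedges that
  only share a boundary halfline form a special pair if their angles add up to less than \<open>pi\<close>.\<close>

definition special_labeled_pair :: "complex set \<Rightarrow> complex set \<Rightarrow> bool" where
  "special_labeled_pair V W \<longleftrightarrow>
     (\<exists>p q \<rho> \<alpha> \<theta> \<beta> \<phi> V0 W0.
        0 < \<theta> \<and> \<theta> < pi \<and> 0 < \<phi> \<and> \<phi> < pi \<and>
        V0 = (\<lambda>z. cis \<rho> * (z - p)) ` V \<and> V0 = wedge 0 \<alpha> \<theta> \<and>
        W0 = (\<lambda>z. cis \<rho> * (z - q)) ` W \<and> W0 = wedge 0 \<beta> \<phi> \<and>
        complex_of_real ` {0..} \<subseteq> W0 \<and>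
        \<not> V0 \<subseteq> W0 \<and> \<not> W0 \<subseteq> V0 \<and>
        ((\<exists>(a, b)\<in>{(\<alpha>, \<alpha> + \<theta>), (\<alpha> + \<theta>, \<alpha>)}.
            halfline a \<subseteq> W0 \<and>
            (halfline b \<subseteq> upper_sector \<beta> \<phi> \<or> halfline b \<subseteq> lower_sector \<beta> \<phi>)) \<or>
         (halfline \<alpha> \<subseteq> upper_sector \<beta> \<phi> \<and> halfline (\<alpha> + \<theta>) \<subseteq> upper_sector \<beta> \<phi>) \<or>
         (halfline \<alpha> \<subseteq> lower_sector \<beta> \<phi> \<and> halfline (\<alpha> + \<theta>) \<subseteq> lower_sector \<beta> \<phi>)))"

definition special_pair :: "complex set \<Rightarrow> complex set \<Rightarrow> bool" where
  "special_pair V W \<longleftrightarrow> special_labeled_pair V W \<or> special_labeled_pair W V"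

datatype color = Red | Blue

end

theory Submission
  imports Defs
begin

text \<open>Let \<open>C\<close> and \<open>D\<close> be the two wedges moved to the origin. Since neither contains the other
  and both lie, up to the apex, in an open halfplane \<open>f > 0\<close> with \<open>f\<close> linear, there are
  \<open>x \<in> interior C - D\<close> and \<open>y \<in> interior D - C\<close> with \<open>f x = f y\<close>, so that neither \<open>x - y\<close> nor
  \<open>y - x\<close> is in \<open>C \<union> D\<close>. The set for \<open>(k, l)\<close> consists of the origin, a tiny copy near \<open>-x\<close> of
  the set for \<open>(k - 1, l)\<close> and a tiny copy near \<open>-y\<close> of the set for \<open>(k, l - 1)\<close>. A translate of
  \<open>C\<close> with apex near \<open>-x\<close> contains the origin and misses the other copy, and a translate of \<open>D\<close>
  with apex near \<open>-x\<close> misses both; the same holds near \<open>-y\<close> with the roles exchanged. If the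
  origin is red, the copy near \<open>-x\<close> can be used, otherwise the one near \<open>-y\<close>. Cardinalities add
  up by Pascal's rule.\<close>

section \<open>The recursive construction\<close>

text \<open>One condition on the whole intersection of the point set with a translate replaces the
  pair "\<open>n\<close> points of one color and none of the other".\<close>

definition monochromatic :: "('a \<Rightarrow> color) \<Rightarrow> color \<Rightarrow> nat \<Rightarrow> 'a set \<Rightarrow> bool" where
  "monochromatic c q n X \<longleftrightarrow> card X = n \<and> (\<forall>z\<in>X. c z = q)"

lemma monochromatic_image:
  assumes "inj f"
  shows "monochromatic c q n (f ` X) \<longleftrightarrow> monochromatic (c \<circ> f) q n X"
  using assms by (auto simp: monochromatic_def card_image inj_on_subset)

lemma monochromatic_insert:
  assumes "monochromatic c q n X" "finite X" "a \<notin> X" "c a = q"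
  shows "monochromatic c q (Suc n) (insert a X)"
  using assms by (auto simp: monochromatic_def)

lemma mem_translate_iff: "z \<in> (+) t ` C \<longleftrightarrow> z - t \<in> C" for t :: "'a::ab_group_add"
  by (auto intro!: image_eqI[of _ _ "z - t"])

text \<open>A cone is invariant under positive dilations, so
  \<open>z \<mapsto> a + e *\<^sub>R z\<close> carries the translate of \<open>C\<close> with apex
  \<open>t\<close> to the one with apex \<open>a + e *\<^sub>R t\<close>. What happens inside the
  small copy is therefore what happens in \<open>A\<close>, as long as the rest \<open>B'\<close> is
  missed.\<close>

lemma copies_Int_translate:
  fixes A :: "'a::real_vector set"
  assumes cone: "\<And>r z. r > 0 \<Longrightarrow> z \<in> C \<Longrightarrow> r *\<^sub>R z \<in> C"
    and "e > 0"
    and B: "\<And>b. b \<in> B' \<Longrightarrow> b - (a + e *\<^sub>R t) \<notin> C"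
  shows "((\<lambda>z. a + e *\<^sub>R z) ` A \<union> B') \<inter> (+) (a + e *\<^sub>R t) ` C = (\<lambda>z. a + e *\<^sub>R z) ` (A \<inter> (+) t ` C)"
proof -
  have "e *\<^sub>R w \<in> C \<longleftrightarrow> w \<in> C" for w
    using cone[of e w] cone[of "inverse e" "e *\<^sub>R w"] \<open>e > 0\<close> by auto
  then have "a + e *\<^sub>R z \<in> (+) (a + e *\<^sub>R t) ` C \<longleftrightarrow> z \<in> (+) t ` C" for z
    unfolding mem_translate_iff by (simp flip: scaleR_diff_right)
  moreover have "b \<notin> (+) (a + e *\<^sub>R t) ` C" if "b \<in> B'" for b
    unfolding mem_translate_iff using B that .
  ultimately show ?thesis by blast
qed

section \<open>Stability under small perturbations and the recursion\<close>

lemma notin_closed_perturb: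
  fixes z :: "'a::real_normed_vector"
  assumes "closed C" "z \<notin> C"
  shows "\<exists>d>0. \<forall>s. norm s < d \<longrightarrow> z + s \<notin> C"
proof -
  have "open (- C)" "z \<in> - C" using assms by auto
  then obtain d where "d > 0" "ball z d \<subseteq> - C" by (rule openE)
  moreover have "z + s \<in> ball z d" if "norm s < d" for s using that by (simp add: dist_norm)
  ultimately show ?thesis by blast
qed

lemma interior_perturb:
  fixes z :: "'a::real_normed_vector"
  assumes "z \<in> interior C"
  shows "\<exists>d>0. \<forall>s. norm s < d \<longrightarrow> z + s \<in> C"
proof -
  obtain d where "d > 0" "ball z d \<subseteq> C"
    using assms unfolding mem_interior by blast
  moreover have "z + s \<in> ball z d" if "norm s < d" for s using that by (simp add: dist_norm)
  ultimately show ?thesis by blast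
qed

text \<open>The bound \<open>M\<close> keeps the apices of the copies of the translates near the copies of the
  point sets when everything is scaled down.\<close>

lemma forcing_set_exists:
  fixes C D :: "'a::real_normed_vector set"
  assumes C: "closed C" "0 \<in> C" "\<And>r z. r > 0 \<Longrightarrow> z \<in> C \<Longrightarrow> r *\<^sub>R z \<in> C"
    and D: "closed D" "0 \<in> D" "\<And>r z. r > 0 \<Longrightarrow> z \<in> D \<Longrightarrow> r *\<^sub>R z \<in> D"
    and x: "x \<in> interior C" "x \<notin> D" and y: "y \<in> interior D" "y \<notin> C"
    and xy: "x - y \<notin> C" "x - y \<notin> D" "y - x \<notin> C" "y - x \<notin> D"
  shows "\<exists>S M. finite S \<and> card S = ((k + l) choose k) - 1 \<and>
    (\<forall>c. \<exists>t. norm t \<le> M \<and>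
       (monochromatic c Red k (S \<inter> (+) t ` C) \<or> monochromatic c Blue l (S \<inter> (+) t ` D)))"
proof -
  \<comment> \<open>\<open>nbhd P\<close> says that \<open>P\<close> holds for all sufficiently
    short vectors. Its stability under conjunction yields one \<open>d\<close> for the eight
    conditions below: memberships persist by interiors, non-memberships by closedness.\<close>
  define nbhd where "nbhd P \<longleftrightarrow> (\<exists>d>0. \<forall>s::'a. norm s < d \<longrightarrow> P s)" for P
  have nbhd_conj: "nbhd (\<lambda>s. P s \<and> Q s)" if P: "nbhd P" and Q: "nbhd Q" for P Q
  proof -
    obtain d1 d2 where "d1 > 0" "\<forall>s. norm s < d1 \<longrightarrow> P s" "d2 > 0" "\<forall>s. norm s < d2 \<longrightarrow> Q s"
      using P Q unfolding nbhd_def by blast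
    then show ?thesis unfolding nbhd_def by (intro exI[of _ "min d1 d2"]) auto
  qed
  have "nbhd (\<lambda>s. (x + s \<in> C \<and> x + s \<notin> D) \<and> (y + s \<in> D \<and> y + s \<notin> C) \<and>
      (x - y + s \<notin> C \<and> x - y + s \<notin> D) \<and> (y - x + s \<notin> C \<and> y - x + s \<notin> D))"
    by (intro nbhd_conj; unfold nbhd_def)
      (use C D x y xy in \<open>auto intro!: notin_closed_perturb interior_perturb\<close>)
  then obtain d where "d > 0" and
    xC: "\<And>s. norm s < d \<Longrightarrow> x + s \<in> C" and xD: "\<And>s. norm s < d \<Longrightarrow> x + s \<notin> D" and
    yD: "\<And>s. norm s < d \<Longrightarrow> y + s \<in> D" and yC: "\<And>s. norm s < d \<Longrightarrow> y + s \<notin> C" and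
    xy: "\<And>s. norm s < d \<Longrightarrow> x - y + s \<notin> C" "\<And>s. norm s < d \<Longrightarrow> x - y + s \<notin> D" and
    yx: "\<And>s. norm s < d \<Longrightarrow> y - x + s \<notin> C" "\<And>s. norm s < d \<Longrightarrow> y - x + s \<notin> D"
    unfolding nbhd_def by blast
  show ?thesis
  proof (induction k arbitrary: l)
    \<comment> \<open>No red point is required and \<open>l choose 0\<close> minus 1 is 0, so the
      empty set works; the case \<open>l = 0\<close> below is analogous.\<close>
    case 0
    show ?case by (intro exI[of _ "{}"] exI[of _ 0]) (auto simp: monochromatic_def intro!: exI[of _ 0])
  next
    case (Suc k)
    \<comment> \<open>The copy near \<open>-x\<close> needs the outer hypothesis at
      \<open>Suc l\<close>, which is why \<open>l\<close> is arbitrary there; the inner hypothesis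
      supplies \<open>(Suc k, l)\<close>.\<close>
    note IHk = Suc.IH
    show ?case
    proof (induction l)
      case 0
      show ?case by (intro exI[of _ "{}"] exI[of _ 0]) (auto simp: monochromatic_def intro!: exI[of _ 0])
    next
      case (Suc l)
      obtain A M1 where A: "finite A" "card A = ((k + Suc l) choose k) - 1" and
        A_forces: "\<And>c. \<exists>t. norm t \<le> M1 \<and>
          (monochromatic c Red k (A \<inter> (+) t ` C) \<or> monochromatic c Blue (Suc l) (A \<inter> (+) t ` D))"
        using IHk[of "Suc l"] by blast
      obtain B M2 where B: "finite B" "card B = ((Suc k + l) choose Suc k) - 1" and
        B_forces: "\<And>c. \<exists>t. norm t \<le> M2 \<and>
          (monochromatic c Red (Suc k) (B \<inter> (+) t ` C) \<or> monochromatic c Blue l (B \<inter> (+) t ` D))"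
        using Suc.IH by blast
      have "bounded (A \<union> B)" using A B by (simp add: finite_imp_bounded)
      then obtain R0 where R0: "\<And>z. z \<in> A \<union> B \<Longrightarrow> norm z \<le> R0" unfolding bounded_iff by blast
      \<comment> \<open>\<open>R\<close> bounds all points of both smaller sets and all apices that
        occur for them; the entry 1 makes it positive.\<close>
      define R where "R = Max {R0, M1, M2, 1}"
      have R: "R0 \<le> R" "M1 \<le> R" "M2 \<le> R" "R \<ge> 1" by (auto simp: R_def)
      have norm_R: "norm z \<le> R" if "z \<in> A \<union> B" for z using R0[OF that] R by linarith
      \<comment> \<open>Two vectors of norm at most \<open>R\<close> differ by at most
        \<open>2 * R\<close>, so after scaling by \<open>e\<close> the difference is at most
        \<open>d / 2\<close>.\<close>
      define e where "e = d / (4 * R)"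
      have "e > 0" using \<open>d > 0\<close> R by (simp add: e_def)
      have small2: "norm (e *\<^sub>R (u - v)) < d" if "norm u \<le> R" "norm v \<le> R" for u v :: 'a
      proof -
        have "norm (u - v) \<le> 2 * R" using norm_triangle_ineq4[of u v] that by linarith
        then have "norm (e *\<^sub>R (u - v)) \<le> e * (2 * R)" using \<open>e > 0\<close> by simp
        also have "\<dots> < d" using R \<open>d > 0\<close> by (simp add: e_def)
        finally show ?thesis .
      qed
      have small: "norm (- (e *\<^sub>R v)) < d" if "norm v \<le> R" for v :: 'a
        using small2[of 0 v] that R by simp
      define f where "f z = - x + e *\<^sub>R z" for z
      define g where "g z = - y + e *\<^sub>R z" for z
      define S where "S = insert 0 (f ` A \<union> g ` B)"
      have "inj f" "inj g" using \<open>e > 0\<close> by (auto simp: inj_on_def f_def g_def)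
      \<comment> \<open>Every position relative to a scaled apex is one of \<open>x\<close>,
        \<open>y\<close>, \<open>x - y\<close>, \<open>y - x\<close> plus a vector that
        \<open>small\<close> or \<open>small2\<close> bounds by \<open>d\<close>.\<close>
      have fx: "- f t = x + - (e *\<^sub>R t)" and gy: "- g t = y + - (e *\<^sub>R t)"
        and gf: "g u - f t = x - y + e *\<^sub>R (u - t)" and fg: "f u - g t = y - x + e *\<^sub>R (u - t)" for t u
        by (simp_all add: f_def g_def algebra_simps)
      \<comment> \<open>If the origin were in a copy, then 0 would be a small perturbation of
        \<open>x\<close> or of \<open>y\<close>, hence outside \<open>D\<close> or outside
        \<open>C\<close>; but both cones contain 0.\<close>
      have 0: "0 \<notin> f ` A" "0 \<notin> g ` B"
        using xD[OF small[OF norm_R]] yC[OF small[OF norm_R]] C(2) D(2)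
        by (metis (no_types, lifting) UnCI fx gy imageE minus_zero)+
      have disj: "f ` A \<inter> g ` B = {}"
      proof -
        have "g v - f u \<noteq> 0" if "u \<in> A" "v \<in> B" for u v
          using xy(1)[OF small2[OF norm_R norm_R], of v u] that C(2) gf by auto
        then show ?thesis by force
      qed
      have "card S = Suc (card A + card B)"
        using 0 disj A B \<open>inj f\<close> \<open>inj g\<close>
        by (simp add: S_def card_Un_disjoint card_image inj_on_subset)
      also have "\<dots> = ((Suc k + Suc l) choose Suc k) - 1"
      proof -
        \<comment> \<open>Positivity keeps the truncated subtractions exact: the origin makes up for
          one of the two subtracted units, and Pascal's rule gives the rest.\<close>
        have "(k + Suc l) choose k > 0" "(Suc k + l) choose Suc k > 0" by simp_all
        moreover have "(Suc k + Suc l) choose Suc k = ((k + Suc l) choose k) + ((Suc k + l) choose Suc k)"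
          by simp
        ultimately show ?thesis using A(2) B(2) by linarith
      qed
      finally have card_S: "card S = ((Suc k + Suc l) choose Suc k) - 1" .
      have fin: "finite S" using A B by (simp add: S_def)
      have forces: "\<exists>t. norm t \<le> norm x + norm y + e * R \<and>
          (monochromatic c Red (Suc k) (S \<inter> (+) t ` C) \<or> monochromatic c Blue (Suc l) (S \<inter> (+) t ` D))" for c
      proof (cases "c 0")
        case Red
        \<comment> \<open>The coloring is pulled back along \<open>f\<close>, so that the hypothesis
          for \<open>A\<close> speaks about the copy near \<open>-x\<close>.\<close>
        obtain t where t: "norm t \<le> M1" and
          hit: "monochromatic (c \<circ> f) Red k (A \<inter> (+) t ` C) \<or> monochromatic (c \<circ> f) Blue (Suc l) (A \<inter> (+) t ` D)"
          using A_forces by blast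
        have tR: "norm t \<le> R" using t R by linarith
        have IC: "(f ` A \<union> g ` B) \<inter> (+) (f t) ` C = f ` (A \<inter> (+) t ` C)"
          by (rule copies_Int_translate[OF C(3) \<open>e > 0\<close>, where a = "- x", folded f_def])
            (use xy(1)[OF small2[OF norm_R tR], folded gf] in auto)
        have ID: "(f ` A \<union> g ` B) \<inter> (+) (f t) ` D = f ` (A \<inter> (+) t ` D)"
          by (rule copies_Int_translate[OF D(3) \<open>e > 0\<close>, where a = "- x", folded f_def])
            (use xy(2)[OF small2[OF norm_R tR], folded gf] in auto)
        \<comment> \<open>The red origin adds one point to the intersection with the translate of
          \<open>C\<close>, raising \<open>k\<close> to \<open>Suc k\<close>, and leaves that of
          \<open>D\<close> unchanged, where \<open>Suc l\<close> blue points are already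
          guaranteed.\<close>
        have "0 \<in> (+) (f t) ` C" "0 \<notin> (+) (f t) ` D"
          unfolding mem_translate_iff using xC[OF small[OF tR]] xD[OF small[OF tR]] fx by auto
        then have SC: "S \<inter> (+) (f t) ` C = insert 0 (f ` (A \<inter> (+) t ` C))"
          and SD: "S \<inter> (+) (f t) ` D = f ` (A \<inter> (+) t ` D)"
          unfolding S_def IC[symmetric] ID[symmetric] by blast+
        have "monochromatic c Red (Suc k) (S \<inter> (+) (f t) ` C) \<or> monochromatic c Blue (Suc l) (S \<inter> (+) (f t) ` D)"
          using hit
        proof
          assume "monochromatic (c \<circ> f) Red k (A \<inter> (+) t ` C)"
          then show ?thesis unfolding SC
            using monochromatic_insert[of c Red k "f ` (A \<inter> (+) t ` C)" 0] 0 A Red \<open>inj f\<close>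
            by (auto simp: monochromatic_image)
        qed (simp add: SD monochromatic_image \<open>inj f\<close>)
        moreover have "norm (f t) \<le> norm x + norm y + e * R"
        proof -
          have "norm (f t) \<le> norm x + e * norm t"
            using norm_triangle_ineq[of "- x" "e *\<^sub>R t"] \<open>e > 0\<close> by (simp add: f_def)
          moreover have "e * norm t \<le> e * R" using tR \<open>e > 0\<close> by simp
          ultimately show ?thesis using norm_ge_zero[of y] by linarith
        qed
        ultimately show ?thesis by blast
      next
        case Blue
        obtain t where t: "norm t \<le> M2" and
          hit: "monochromatic (c \<circ> g) Red (Suc k) (B \<inter> (+) t ` C) \<or> monochromatic (c \<circ> g) Blue l (B \<inter> (+) t ` D)"
          using B_forces by blast
        have tR: "norm t \<le> R" using t R by linarith
        have IC: "(g ` B \<union> f ` A) \<inter> (+) (g t) ` C = g ` (B \<inter> (+) t ` C)"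
          by (rule copies_Int_translate[OF C(3) \<open>e > 0\<close>, where a = "- y", folded g_def])
            (use yx(1)[OF small2[OF norm_R tR], folded fg] in auto)
        have ID: "(g ` B \<union> f ` A) \<inter> (+) (g t) ` D = g ` (B \<inter> (+) t ` D)"
          by (rule copies_Int_translate[OF D(3) \<open>e > 0\<close>, where a = "- y", folded g_def])
            (use yx(2)[OF small2[OF norm_R tR], folded fg] in auto)
        \<comment> \<open>With the roles exchanged, the blue origin raises \<open>l\<close> to
          \<open>Suc l\<close> in the translate of \<open>D\<close>, while the translate of
          \<open>C\<close> avoids it.\<close>
        have "0 \<notin> (+) (g t) ` C" "0 \<in> (+) (g t) ` D"
          unfolding mem_translate_iff using yC[OF small[OF tR]] yD[OF small[OF tR]] gy by auto
        then have SC: "S \<inter> (+) (g t) ` C = g ` (B \<inter> (+) t ` C)"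
          and SD: "S \<inter> (+) (g t) ` D = insert 0 (g ` (B \<inter> (+) t ` D))"
          unfolding S_def IC[symmetric] ID[symmetric] by blast+
        have "monochromatic c Red (Suc k) (S \<inter> (+) (g t) ` C) \<or> monochromatic c Blue (Suc l) (S \<inter> (+) (g t) ` D)"
          using hit
        proof
          assume "monochromatic (c \<circ> g) Blue l (B \<inter> (+) t ` D)"
          then show ?thesis unfolding SD
            using monochromatic_insert[of c Blue l "g ` (B \<inter> (+) t ` D)" 0] 0 B Blue \<open>inj g\<close>
            by (auto simp: monochromatic_image)
        qed (simp add: SC monochromatic_image \<open>inj g\<close>)
        moreover have "norm (g t) \<le> norm x + norm y + e * R"
        proof -
          have "norm (g t) \<le> norm y + e * norm t"
            using norm_triangle_ineq[of "- y" "e *\<^sub>R t"] \<open>e > 0\<close> by (simp add: g_def)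
          moreover have "e * norm t \<le> e * R" using tR \<open>e > 0\<close> by simp
          ultimately show ?thesis using norm_ge_zero[of x] by linarith
        qed
        ultimately show ?thesis by blast
      qed
      show ?case using fin card_S forces by blast
    qed
  qed
qed

section \<open>Wedges as closed convex cones\<close>

lemma Im_mult_cis: "Im (of_real r * cis t * cis s) = r * sin (t + s)"
  by (simp add: mult.assoc cis_mult)

text \<open>Multiplication by \<open>cis (- \<alpha>)\<close> turns the first boundary direction
  into the positive real one, so the sign of the imaginary part tells the side of the boundary line;
  likewise for the second. An angle below \<open>pi\<close> makes the wedge the intersection of the
  two sides.\<close>

lemma wedge_eq_halfplanes:
  assumes "0 < \<theta>" "\<theta> < pi"
  shows "wedge 0 \<alpha> \<theta> = {z. 0 \<le> Im (z * cis (- \<alpha>)) \<and> Im (z * cis (- (\<alpha> + \<theta>))) \<le> 0}"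
proof (intro set_eqI iffI)
  fix z assume "z \<in> wedge 0 \<alpha> \<theta>"
  then obtain r t where z: "z = of_real r * cis t" "0 \<le> r" "\<alpha> \<le> t" "t \<le> \<alpha> + \<theta>"
    by (auto simp: wedge_def)
  have "sin (t + - \<alpha>) \<ge> 0" using z assms by (intro sin_ge_zero) auto
  moreover have "sin (\<alpha> + \<theta> - t) \<ge> 0" using z assms by (intro sin_ge_zero) auto
  then have "sin (t + - (\<alpha> + \<theta>)) \<le> 0" using sin_minus[of "\<alpha> + \<theta> - t"] by (simp add: algebra_simps)
  ultimately show "z \<in> {z. 0 \<le> Im (z * cis (- \<alpha>)) \<and> Im (z * cis (- (\<alpha> + \<theta>))) \<le> 0}"
    unfolding z(1) mem_Collect_eq Im_mult_cis using z(2)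
    by (simp add: mult_nonneg_nonneg mult_nonneg_nonpos)
next
  fix z assume z: "z \<in> {z. 0 \<le> Im (z * cis (- \<alpha>)) \<and> Im (z * cis (- (\<alpha> + \<theta>))) \<le> 0}"
  show "z \<in> wedge 0 \<alpha> \<theta>"
  proof (cases "z = 0")
    case True
    then show ?thesis using assms by (auto simp: wedge_def intro!: exI[of _ 0] exI[of _ \<alpha>])
  next
    case False
    \<comment> \<open>\<open>\<tau>\<close> is the angle measured from the first boundary halfline.
      The first inequality puts it into \<open>[0, pi]\<close>; the second excludes
      \<open>\<tau> > \<theta>\<close>, where the sine of \<open>\<tau> - \<theta>\<close> would be
      positive.\<close>
    define \<tau> where "\<tau> = Arg (z * cis (- \<alpha>))"
    have "z * cis (- \<alpha>) = of_real (norm z) * cis \<tau>"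
      using rcis_cmod_Arg[of "z * cis (- \<alpha>)"] by (simp add: \<tau>_def norm_mult rcis_def)
    then have "z * cis (- \<alpha>) * cis \<alpha> = of_real (norm z) * cis \<tau> * cis \<alpha>" by simp
    then have zeq: "z = of_real (norm z) * cis (\<alpha> + \<tau>)"
      by (simp add: mult.assoc cis_mult add.commute)
    have "0 \<le> Im (z * cis (- \<alpha>))" using z by simp
    then have \<tau>: "0 \<le> \<tau>" "\<tau> \<le> pi"
      unfolding \<tau>_def by (simp_all only: Arg_less_0 Arg_le_pi)
    have "Im (z * cis (- (\<alpha> + \<theta>))) = norm z * sin (\<alpha> + \<tau> + - (\<alpha> + \<theta>))"
      by (subst zeq, rule Im_mult_cis)
    then have "norm z * sin (\<tau> - \<theta>) \<le> 0" using z by (simp add: algebra_simps)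
    then have "sin (\<tau> - \<theta>) \<le> 0" using False by (simp add: mult_le_0_iff)
    moreover have "sin (\<tau> - \<theta>) > 0" if "\<tau> > \<theta>" using that \<tau> assms by (intro sin_gt_zero) auto
    ultimately have "\<tau> \<le> \<theta>" by force
    moreover have "z = 0 + of_real (norm z) * cis (\<alpha> + \<tau>)" using zeq by simp
    ultimately show ?thesis using \<tau> norm_ge_zero[of z] unfolding wedge_def
      by (smt (verit) mem_Collect_eq)
  qed
qed

lemma wedge_subset_span:
  assumes "0 < \<theta>" "\<theta> < pi" "z \<in> wedge 0 \<alpha> \<theta>"
  obtains r s where "0 \<le> r" "0 \<le> s" "z = of_real r * cis \<alpha> + of_real s * cis (\<alpha> + \<theta>)"
proof
  have "sin \<theta> > 0" using assms by (intro sin_gt_zero)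
  \<comment> \<open>Cramer's rule: the coefficients are the signed distances from \<open>z\<close>
    to the two boundary lines, divided by \<open>sin \<theta>\<close>. The halfplane description
    gives their signs.\<close>
  define r where "r = - Im (z * cis (- (\<alpha> + \<theta>))) / sin \<theta>"
  define s where "s = Im (z * cis (- \<alpha>)) / sin \<theta>"
  show "r \<ge> 0" "s \<ge> 0"
    using assms \<open>sin \<theta> > 0\<close> by (simp_all add: wedge_eq_halfplanes r_def s_def divide_le_0_iff)
  obtain q t where z: "z = of_real q * cis t" using assms by (auto simp: wedge_def)
  have s: "s * sin \<theta> = q * sin (t - \<alpha>)" and r: "r * sin \<theta> = q * sin (\<alpha> + \<theta> - t)"
    using \<open>sin \<theta> > 0\<close> Im_mult_cis[of q t "- \<alpha>"] Im_mult_cis[of q t "- (\<alpha> + \<theta>)"]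
      sin_minus[of "\<alpha> + \<theta> - t"]
    by (simp_all add: r_def s_def z algebra_simps)
  define w where "w = t - \<alpha>"
  have t: "t = \<alpha> + w" by (simp add: w_def)
  have id: "sin \<theta> * cis t = sin (\<alpha> + \<theta> - t) * cis \<alpha> + sin (t - \<alpha>) * cis (\<alpha> + \<theta>)"
    unfolding t by (auto simp: complex_eq_iff sin_diff cos_add sin_add algebra_simps)
  have "of_real (sin \<theta>) * z = of_real q * (sin \<theta> * cis t)" by (simp add: z)
  also have "\<dots> = of_real (r * sin \<theta>) * cis \<alpha> + of_real (s * sin \<theta>) * cis (\<alpha> + \<theta>)"
    unfolding id r s by (simp add: algebra_simps)
  also have "\<dots> = of_real (sin \<theta>) * (of_real r * cis \<alpha> + of_real s * cis (\<alpha> + \<theta>))"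
    by (simp add: algebra_simps)
  finally show "z = of_real r * cis \<alpha> + of_real s * cis (\<alpha> + \<theta>)"
    using \<open>sin \<theta> > 0\<close> by simp
qed

section \<open>Closedness, convexity and interior of wedges\<close>

lemma closed_wedge: "0 < \<theta> \<Longrightarrow> \<theta> < pi \<Longrightarrow> closed (wedge 0 \<alpha> \<theta>)"
  by (simp only: wedge_eq_halfplanes)
    (intro closed_Collect_conj closed_Collect_le continuous_intros)

lemma convex_wedge:
  assumes "0 < \<theta>" "\<theta> < pi"
  shows "convex (wedge 0 \<alpha> \<theta>)"
proof (rule convexI)
  fix z w :: complex and u v :: real
  assume *: "z \<in> wedge 0 \<alpha> \<theta>" "w \<in> wedge 0 \<alpha> \<theta>" "0 \<le> u" "0 \<le> v" "u + v = 1"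
  have "Im ((u *\<^sub>R z + v *\<^sub>R w) * c) = u * Im (z * c) + v * Im (w * c)" for c
    by (simp add: algebra_simps)
  then show "u *\<^sub>R z + v *\<^sub>R w \<in> wedge 0 \<alpha> \<theta>"
    using * unfolding wedge_eq_halfplanes[OF assms] mem_Collect_eq
    by (simp only:) (intro conjI add_nonneg_nonneg add_nonpos_nonpos
      mult_nonneg_nonneg mult_nonneg_nonpos; simp only:)
qed

lemma interior_wedge_nonempty:
  assumes "0 < \<theta>" "\<theta> < pi"
  shows "interior (wedge 0 \<alpha> \<theta>) \<noteq> {}"
proof -
  let ?U = "{z. 0 < Im (z * cis (- \<alpha>)) \<and> Im (z * cis (- (\<alpha> + \<theta>))) < 0}"
  have "open ?U" by (intro open_Collect_conj open_Collect_less continuous_intros)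
  moreover have "?U \<subseteq> wedge 0 \<alpha> \<theta>" by (auto simp: wedge_eq_halfplanes[OF assms])
  \<comment> \<open>The bisecting direction satisfies both strict inequalities.\<close>
  moreover have "cis (\<alpha> + \<theta> / 2) \<in> ?U"
    using sin_gt_zero[of "\<theta> / 2"] assms
    by (simp only: mem_Collect_eq cis_mult cis.simps) (simp add: field_simps)
  ultimately show ?thesis using interior_maximal by blast
qed

lemma wedge_zero_mem: "0 < \<theta> \<Longrightarrow> 0 \<in> wedge 0 \<alpha> \<theta>"
  by (auto simp: wedge_def intro!: exI[of _ 0] exI[of _ \<alpha>])

lemma wedge_scale:
  assumes "z \<in> wedge 0 \<alpha> \<theta>" "0 < r"
  shows "r *\<^sub>R z \<in> wedge 0 \<alpha> \<theta>"
proof -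
  obtain q t where "z = of_real q * cis t" "0 \<le> q" "\<alpha> \<le> t" "t \<le> \<alpha> + \<theta>"
    using assms by (auto simp: wedge_def)
  moreover from this have "r *\<^sub>R z = 0 + of_real (r * q) * cis t" "0 \<le> r * q"
    using assms by (simp_all add: scaleR_conv_of_real)
  ultimately show ?thesis unfolding wedge_def by blast
qed

text \<open>A convex set with nonempty interior lies in the closure of its interior. If the interior
  were inside the closed set \<open>W\<close>, so would be the whole wedge.\<close>

lemma interior_wedge_minus_closed:
  assumes "0 < \<theta>" "\<theta> < pi" "closed W" "\<not> wedge 0 \<alpha> \<theta> \<subseteq> W"
  obtains x where "x \<in> interior (wedge 0 \<alpha> \<theta>)" "x \<notin> W"
proof -
  have "wedge 0 \<alpha> \<theta> \<subseteq> closure (interior (wedge 0 \<alpha> \<theta>))"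
    using convex_closure_interior[OF convex_wedge interior_wedge_nonempty] assms closure_subset by blast
  then have "\<not> interior (wedge 0 \<alpha> \<theta>) \<subseteq> W"
    using assms closure_minimal[of "interior (wedge 0 \<alpha> \<theta>)" W] by blast
  then show ?thesis using that by blast
qed

section \<open>Special pairs\<close>

text \<open>The linear functional \<open>z \<mapsto> Re (z * w)\<close> is positive on both boundary
  directions, hence on their nonnegative combinations other than 0.\<close>

lemma wedge_in_halfplane:
  assumes "0 < \<theta>" "\<theta> < pi" "z \<in> wedge 0 \<alpha> \<theta>" "z \<noteq> 0"
    and "Re (cis \<alpha> * w) > 0" "Re (cis (\<alpha> + \<theta>) * w) > 0"
  shows "Re (z * w) > 0"
proof -
  obtain r s where rs: "0 \<le> r" "0 \<le> s" and z: "z = of_real r * cis \<alpha> + of_real s * cis (\<alpha> + \<theta>)"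
    using wedge_subset_span assms by blast
  have "Re (z * w) = r * Re (cis \<alpha> * w) + s * Re (cis (\<alpha> + \<theta>) * w)"
    unfolding z by (simp add: algebra_simps)
  moreover have "r > 0 \<or> s > 0" using rs z \<open>z \<noteq> 0\<close> by force
  ultimately show ?thesis using rs assms(5,6)
    by (auto intro: add_pos_nonneg add_nonneg_pos)
qed

section \<open>Boundary directions in a common open halfplane\<close>

lemma halfline_subset_Union_cis:
  assumes "halfline a \<subseteq> (\<Union>t\<in>T. halfline t)"
  shows "\<exists>t\<in>T. cis a = cis t"
proof -
  \<comment> \<open>The unit vector lies on some halfline of the union, and comparing norms gives
    radius 1. The directions thus agree modulo \<open>2 * pi\<close>, which equality under
    \<open>cis\<close> expresses.\<close>
  have "cis a \<in> halfline a" by (auto simp: halfline_def intro!: exI[of _ 1])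
  then obtain t where "t \<in> T" "cis a \<in> halfline t" using assms by blast
  then obtain r where *: "cis a = of_real r * cis t" "r > 0" by (auto simp: halfline_def)
  from * have "norm (cis a) = r" by (simp add: norm_mult)
  then have "r = 1" by simp
  then show ?thesis using * \<open>t \<in> T\<close> by auto
qed

lemma halfline_subset_wedge_cis:
  assumes "halfline a \<subseteq> wedge 0 \<beta> \<phi>"
  shows "\<exists>t\<in>{\<beta>..\<beta> + \<phi>}. cis a = cis t"
proof (rule halfline_subset_Union_cis)
  have "z \<in> (\<Union>t\<in>{\<beta>..\<beta> + \<phi>}. halfline t)" if "z \<in> wedge 0 \<beta> \<phi>" "z \<noteq> 0" for z
    using that by (force simp: wedge_def halfline_def)
  moreover have "0 \<notin> halfline a" by (auto simp: halfline_def)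
  ultimately show "halfline a \<subseteq> (\<Union>t\<in>{\<beta>..\<beta> + \<phi>}. halfline t)" using assms by blast
qed

text \<open>All four boundary directions lie in an interval of length less than \<open>pi\<close>; the halfplane is
  the one around the midpoint of the interval.\<close>

lemma directions_in_halfplane:
  assumes "hi - lo < pi" "\<And>a. a \<in> T \<Longrightarrow> \<exists>t\<in>{lo..hi}. cis a = cis t"
  shows "\<exists>w. \<forall>a\<in>T. Re (cis a * w) > 0"
proof (intro exI ballI)
  fix a assume "a \<in> T"
  then obtain t where t: "t \<in> {lo..hi}" "cis a = cis t" using assms by blast
  have "cos (t - (lo + hi) / 2) > 0"
  proof (rule cos_gt_zero_pi)
    show "- (pi / 2) < t - (lo + hi) / 2" using t(1) assms(1) by (simp add: field_simps)
    show "t - (lo + hi) / 2 < pi / 2" using t(1) assms(1) by (simp add: field_simps)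
  qed
  then show "Re (cis a * cis (- ((lo + hi) / 2))) > 0" by (simp add: t(2) cis_mult)
qed

text \<open>No alternative uses both Upper and Lower. Modulo \<open>2 * pi\<close>, all four
  directions therefore lie in the half-open interval of length \<open>pi\<close> starting at
  \<open>\<beta>\<close>, or in the one ending at \<open>\<beta> + \<phi>\<close>.\<close>

lemma special_directions_in_halfplane:
  assumes "0 < \<phi>" "\<phi> < pi"
    and pos: "(\<exists>(a, b)\<in>{(\<alpha>, \<alpha> + \<theta>), (\<alpha> + \<theta>, \<alpha>)}.
            halfline a \<subseteq> wedge 0 \<beta> \<phi> \<and>
            (halfline b \<subseteq> upper_sector \<beta> \<phi> \<or> halfline b \<subseteq> lower_sector \<beta> \<phi>)) \<or>
         (halfline \<alpha> \<subseteq> upper_sector \<beta> \<phi> \<and> halfline (\<alpha> + \<theta>) \<subseteq> upper_sector \<beta> \<phi>) \<or>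
         (halfline \<alpha> \<subseteq> lower_sector \<beta> \<phi> \<and> halfline (\<alpha> + \<theta>) \<subseteq> lower_sector \<beta> \<phi>)"
  shows "\<exists>w. \<forall>a\<in>{\<alpha>, \<alpha> + \<theta>, \<beta>, \<beta> + \<phi>}. Re (cis a * w) > 0"
proof -
  have up: "\<exists>t\<in>{\<beta> + \<phi><..<\<beta> + pi}. cis a = cis t" if "halfline a \<subseteq> upper_sector \<beta> \<phi>" for a
    using halfline_subset_Union_cis that unfolding upper_sector_def by blast
  have low: "\<exists>t\<in>{\<beta> + \<phi> - pi<..<\<beta>}. cis a = cis t" if "halfline a \<subseteq> lower_sector \<beta> \<phi>" for a
    using halfline_subset_Union_cis that unfolding lower_sector_def by blast
  consider
    (upper) s t where "cis \<alpha> = cis s" "cis (\<alpha> + \<theta>) = cis t" "s \<in> {\<beta>..<\<beta> + pi}" "t \<in> {\<beta>..<\<beta> + pi}"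
  | (lower) s t where "cis \<alpha> = cis s" "cis (\<alpha> + \<theta>) = cis t"
      "s \<in> {\<beta> + \<phi> - pi<..\<beta> + \<phi>}" "t \<in> {\<beta> + \<phi> - pi<..\<beta> + \<phi>}"
  proof -
    have U: thesis if "\<exists>s\<in>{\<beta>..<\<beta> + pi}. cis \<alpha> = cis s" "\<exists>t\<in>{\<beta>..<\<beta> + pi}. cis (\<alpha> + \<theta>) = cis t"
      using that upper by blast
    have L: thesis if "\<exists>s\<in>{\<beta> + \<phi> - pi<..\<beta> + \<phi>}. cis \<alpha> = cis s"
      "\<exists>t\<in>{\<beta> + \<phi> - pi<..\<beta> + \<phi>}. cis (\<alpha> + \<theta>) = cis t"
      using that lower by blast
    have sub: "{\<beta> + \<phi><..<\<beta> + pi} \<subseteq> {\<beta>..<\<beta> + pi}" "{\<beta>..\<beta> + \<phi>} \<subseteq> {\<beta>..<\<beta> + pi}"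
      "{\<beta> + \<phi> - pi<..<\<beta>} \<subseteq> {\<beta> + \<phi> - pi<..\<beta> + \<phi>}" "{\<beta>..\<beta> + \<phi>} \<subseteq> {\<beta> + \<phi> - pi<..\<beta> + \<phi>}"
      using assms(1,2) by auto
    have up': "\<exists>t\<in>{\<beta>..<\<beta> + pi}. cis a = cis t"
      if "halfline a \<subseteq> upper_sector \<beta> \<phi> \<or> halfline a \<subseteq> wedge 0 \<beta> \<phi>" for a
      using that up halfline_subset_wedge_cis sub(1,2) by (meson subsetD)
    have low': "\<exists>t\<in>{\<beta> + \<phi> - pi<..\<beta> + \<phi>}. cis a = cis t"
      if "halfline a \<subseteq> lower_sector \<beta> \<phi> \<or> halfline a \<subseteq> wedge 0 \<beta> \<phi>" for a
      using that low halfline_subset_wedge_cis sub(3,4) by (meson subsetD)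
    have "(\<forall>a\<in>{\<alpha>, \<alpha> + \<theta>}. halfline a \<subseteq> upper_sector \<beta> \<phi> \<or> halfline a \<subseteq> wedge 0 \<beta> \<phi>) \<or>
       (\<forall>a\<in>{\<alpha>, \<alpha> + \<theta>}. halfline a \<subseteq> lower_sector \<beta> \<phi> \<or> halfline a \<subseteq> wedge 0 \<beta> \<phi>)"
      using pos by auto
    then show thesis using U L up' low' by blast
  qed
  then show ?thesis
  proof cases
    case upper
    show ?thesis
    proof (rule directions_in_halfplane)
      \<comment> \<open>Finitely many directions below \<open>\<beta> + pi\<close> have a maximum
        below it, so the half-open interval shrinks to a closed one shorter than
        \<open>pi\<close>.\<close>
      show "max (\<beta> + \<phi>) (max s t) - \<beta> < pi" using upper assms(2) by auto
      fix a assume "a \<in> {\<alpha>, \<alpha> + \<theta>, \<beta>, \<beta> + \<phi>}"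
      moreover have "{s, t, \<beta>, \<beta> + \<phi>} \<subseteq> {\<beta>..max (\<beta> + \<phi>) (max s t)}" using upper assms(1) by auto
      ultimately show "\<exists>t\<in>{\<beta>..max (\<beta> + \<phi>) (max s t)}. cis a = cis t" using upper(1,2) by blast
    qed
  next
    case lower
    show ?thesis
    proof (rule directions_in_halfplane)
      show "\<beta> + \<phi> - min \<beta> (min s t) < pi" using lower assms(2) by auto
      fix a assume "a \<in> {\<alpha>, \<alpha> + \<theta>, \<beta>, \<beta> + \<phi>}"
      moreover have "{s, t, \<beta>, \<beta> + \<phi>} \<subseteq> {min \<beta> (min s t)..\<beta> + \<phi>}" using lower assms(1) by auto
      ultimately show "\<exists>t\<in>{min \<beta> (min s t)..\<beta> + \<phi>}. cis a = cis t" using lower(1,2) by blast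
    qed
  qed
qed

section \<open>Undoing the rotation and the translations\<close>

lemma wedge_rotate: "(*) (cis \<rho>) ` wedge 0 \<alpha> \<theta> = wedge 0 (\<alpha> + \<rho>) \<theta>"
proof -
  have *: "(*) (cis \<rho>) ` wedge 0 \<alpha> \<theta> \<subseteq> wedge 0 (\<alpha> + \<rho>) \<theta>" for \<rho> \<alpha>
  proof
    fix z assume "z \<in> (*) (cis \<rho>) ` wedge 0 \<alpha> \<theta>"
    then obtain r t where "z = cis \<rho> * (of_real r * cis t)" "0 \<le> r" "\<alpha> \<le> t" "t \<le> \<alpha> + \<theta>"
      by (auto simp: wedge_def)
    then have "z = 0 + of_real r * cis (t + \<rho>)" "0 \<le> r" "\<alpha> + \<rho> \<le> t + \<rho>" "t + \<rho> \<le> \<alpha> + \<rho> + \<theta>"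
      by (simp_all add: cis_mult[symmetric])
    then show "z \<in> wedge 0 (\<alpha> + \<rho>) \<theta>" unfolding wedge_def by blast
  qed
  \<comment> \<open>The reverse inclusion comes from the first one for the inverse rotation.\<close>
  have "wedge 0 (\<alpha> + \<rho>) \<theta> = (*) (cis \<rho>) ` (*) (cis (- \<rho>)) ` wedge 0 (\<alpha> + \<rho>) \<theta>"
    by (simp add: image_image mult.assoc[symmetric] cis_mult)
  also have "\<dots> \<subseteq> (*) (cis \<rho>) ` wedge 0 \<alpha> \<theta>"
    using *[of "- \<rho>" "\<alpha> + \<rho>"] by (intro image_mono) simp
  finally show ?thesis using *[of \<rho> \<alpha>] by blast
qed

lemma preimage_wedge:
  assumes "(\<lambda>z. cis \<rho> * (z - p)) ` V = wedge 0 \<alpha> \<theta>"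
  shows "V = (+) p ` wedge 0 (\<alpha> - \<rho>) \<theta>"
proof -
  have "(+) p ` wedge 0 (\<alpha> - \<rho>) \<theta> = (+) p ` (*) (cis (- \<rho>)) ` (\<lambda>z. cis \<rho> * (z - p)) ` V"
    using wedge_rotate[of "- \<rho>" \<alpha> \<theta>] assms by simp
  also have "\<dots> = V" by (simp add: image_image mult.assoc[symmetric] cis_mult)
  finally show ?thesis by simp
qed

text \<open>This returns to the original orientation: the boundary angles decrease by
  \<open>\<rho>\<close>, and the functional given by \<open>w\<close> becomes the one given by
  \<open>cis \<rho> * w\<close>.\<close>

lemma special_labeled_pair_wedges:
  assumes "special_labeled_pair V W"
  obtains p q \<alpha> \<theta> \<beta> \<phi> w where "0 < \<theta>" "\<theta> < pi" "0 < \<phi>" "\<phi> < pi"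
    "V = (+) p ` wedge 0 \<alpha> \<theta>" "W = (+) q ` wedge 0 \<beta> \<phi>"
    "\<not> wedge 0 \<alpha> \<theta> \<subseteq> wedge 0 \<beta> \<phi>" "\<not> wedge 0 \<beta> \<phi> \<subseteq> wedge 0 \<alpha> \<theta>"
    "\<And>z. z \<in> wedge 0 \<alpha> \<theta> \<union> wedge 0 \<beta> \<phi> \<Longrightarrow> z \<noteq> 0 \<Longrightarrow> Re (z * w) > 0"
proof -
  from assms obtain p q \<rho> \<alpha> \<theta> \<beta> \<phi> V0 W0 where
    ang: "0 < \<theta>" "\<theta> < pi" "0 < \<phi>" "\<phi> < pi" and
    V0: "V0 = (\<lambda>z. cis \<rho> * (z - p)) ` V" "V0 = wedge 0 \<alpha> \<theta>" and
    W0: "W0 = (\<lambda>z. cis \<rho> * (z - q)) ` W" "W0 = wedge 0 \<beta> \<phi>" and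
    "complex_of_real ` {0..} \<subseteq> W0" and
    nsub0: "\<not> V0 \<subseteq> W0" "\<not> W0 \<subseteq> V0" and
    pos0: "(\<exists>(a, b)\<in>{(\<alpha>, \<alpha> + \<theta>), (\<alpha> + \<theta>, \<alpha>)}.
            halfline a \<subseteq> W0 \<and>
            (halfline b \<subseteq> upper_sector \<beta> \<phi> \<or> halfline b \<subseteq> lower_sector \<beta> \<phi>)) \<or>
         (halfline \<alpha> \<subseteq> upper_sector \<beta> \<phi> \<and> halfline (\<alpha> + \<theta>) \<subseteq> upper_sector \<beta> \<phi>) \<or>
         (halfline \<alpha> \<subseteq> lower_sector \<beta> \<phi> \<and> halfline (\<alpha> + \<theta>) \<subseteq> lower_sector \<beta> \<phi>)"
    unfolding special_labeled_pair_def by (elim exE conjE) (rule that)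
  note V = trans[OF V0(1)[symmetric] V0(2)] and W = trans[OF W0(1)[symmetric] W0(2)]
    and nsub = nsub0[unfolded V0(2) W0(2)] and pos = pos0[unfolded W0(2)]
  obtain w where w: "\<forall>a\<in>{\<alpha>, \<alpha> + \<theta>, \<beta>, \<beta> + \<phi>}. Re (cis a * w) > 0"
    using special_directions_in_halfplane[OF ang(3,4) pos] by blast
  have rot: "wedge 0 \<gamma> \<psi> = (*) (cis \<rho>) ` wedge 0 (\<gamma> - \<rho>) \<psi>" for \<gamma> \<psi>
    using wedge_rotate[of \<rho> "\<gamma> - \<rho>" \<psi>] by simp
  have pos': "Re (z * (cis \<rho> * w)) > 0"
    if "z \<in> wedge 0 (\<alpha> - \<rho>) \<theta> \<union> wedge 0 (\<beta> - \<rho>) \<phi>" "z \<noteq> 0" for z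
  proof -
    have "cis \<rho> * z \<in> wedge 0 \<alpha> \<theta> \<union> wedge 0 \<beta> \<phi>" using that rot by blast
    then have "Re (cis \<rho> * z * w) > 0"
      using wedge_in_halfplane[of \<theta> "cis \<rho> * z" \<alpha> w] wedge_in_halfplane[of \<phi> "cis \<rho> * z" \<beta> w]
        w ang that(2) by auto
    then show ?thesis by (simp only: mult_ac)
  qed
  show ?thesis
  proof (rule that[OF ang preimage_wedge[OF V] preimage_wedge[OF W]])
    show "\<not> wedge 0 (\<alpha> - \<rho>) \<theta> \<subseteq> wedge 0 (\<beta> - \<rho>) \<phi>" "\<not> wedge 0 (\<beta> - \<rho>) \<phi> \<subseteq> wedge 0 (\<alpha> - \<rho>) \<theta>"
      using nsub rot image_mono by metis+
  qed (rule pos')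
qed

text \<open>The extracted data are symmetric in the two wedges, so both labelings lead to the same
  conclusion.\<close>

lemma special_pair_wedges:
  assumes "special_pair V W"
  obtains p q \<alpha> \<theta> \<beta> \<phi> w where "0 < \<theta>" "\<theta> < pi" "0 < \<phi>" "\<phi> < pi"
    "V = (+) p ` wedge 0 \<alpha> \<theta>" "W = (+) q ` wedge 0 \<beta> \<phi>"
    "\<not> wedge 0 \<alpha> \<theta> \<subseteq> wedge 0 \<beta> \<phi>" "\<not> wedge 0 \<beta> \<phi> \<subseteq> wedge 0 \<alpha> \<theta>"
    "\<And>z. z \<in> wedge 0 \<alpha> \<theta> \<union> wedge 0 \<beta> \<phi> \<Longrightarrow> z \<noteq> 0 \<Longrightarrow> Re (z * w) > 0"
  using assms unfolding special_pair_def
proof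
  assume "special_labeled_pair V W"
  then show thesis by (rule special_labeled_pair_wedges) (rule that)
next
  assume "special_labeled_pair W V"
  then obtain p q \<alpha> \<theta> \<beta> \<phi> w where *: "0 < \<theta>" "\<theta> < pi" "0 < \<phi>" "\<phi> < pi"
    "W = (+) p ` wedge 0 \<alpha> \<theta>" "V = (+) q ` wedge 0 \<beta> \<phi>"
    "\<not> wedge 0 \<alpha> \<theta> \<subseteq> wedge 0 \<beta> \<phi>" "\<not> wedge 0 \<beta> \<phi> \<subseteq> wedge 0 \<alpha> \<theta>"
    "\<And>z. z \<in> wedge 0 \<alpha> \<theta> \<union> wedge 0 \<beta> \<phi> \<Longrightarrow> z \<noteq> 0 \<Longrightarrow> Re (z * w) > 0"
    by (rule special_labeled_pair_wedges) (rule that)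
  show thesis by (rule that[OF *(3,4,1,2,6,5,8,7) *(9)]) auto
qed

text \<open>Since \<open>V\<close> has its apex at \<open>p\<close>, the translate of
  \<open>V\<close> by \<open>t - p\<close> is the translate of the cone \<open>C\<close> by
  \<open>t\<close>.\<close>

lemma monochromatic_translate_imp:
  fixes V C S :: "'a::ab_group_add set"
  assumes "V = (+) p ` C" "monochromatic c q n (S \<inter> (+) t ` C)" "q \<noteq> q'"
  shows "\<exists>t. card {z \<in> S \<inter> (+) t ` V. c z = q} = n \<and> {z \<in> S \<inter> (+) t ` V. c z = q'} = {}"
proof -
  have "(+) (t - p) ` V = (+) t ` C" for t
    by (simp add: assms(1) image_image add.assoc[symmetric])
  moreover have "{z \<in> S \<inter> (+) t ` C. c z = q} = S \<inter> (+) t ` C"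
    using assms(2) unfolding monochromatic_def by blast
  ultimately show ?thesis using assms(2,3)
    by (intro exI[of _ "t - p"]) (auto simp: monochromatic_def)
qed

theorem theorem4p1:
  fixes V W :: "complex set" and k l :: nat
  assumes "special_pair V W" and "k \<ge> 1" and "l \<ge> 1"
  shows "\<exists>S :: complex set. finite S \<and> card S = ((k + l) choose k) - 1 \<and>
    (\<forall>c :: complex \<Rightarrow> color.
       (\<exists>t. card {z \<in> S \<inter> (+) t ` V. c z = Red} = k \<and> {z \<in> S \<inter> (+) t ` V. c z = Blue} = {}) \<or>
       (\<exists>t. card {z \<in> S \<inter> (+) t ` W. c z = Blue} = l \<and> {z \<in> S \<inter> (+) t ` W. c z = Red} = {}))"
proof -
  obtain p q \<alpha> \<theta> \<beta> \<phi> w where ang: "0 < \<theta>" "\<theta> < pi" "0 < \<phi>" "\<phi> < pi" and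
    V: "V = (+) p ` wedge 0 \<alpha> \<theta>" and W: "W = (+) q ` wedge 0 \<beta> \<phi>" and
    nsub: "\<not> wedge 0 \<alpha> \<theta> \<subseteq> wedge 0 \<beta> \<phi>" "\<not> wedge 0 \<beta> \<phi> \<subseteq> wedge 0 \<alpha> \<theta>" and
    pos: "\<And>z. z \<in> wedge 0 \<alpha> \<theta> \<union> wedge 0 \<beta> \<phi> \<Longrightarrow> z \<noteq> 0 \<Longrightarrow> Re (z * w) > 0"
    by (rule special_pair_wedges[OF assms(1)]) (rule that)
  let ?C = "wedge 0 \<alpha> \<theta>" and ?D = "wedge 0 \<beta> \<phi>"
  \<comment> \<open>The interior of \<open>A\<close> and the complement of \<open>B\<close> are
    invariant under positive scaling, and the functional is positive at \<open>x\<close>, which is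
    nonzero because \<open>B\<close> contains 0. Hence \<open>x\<close> can be moved to the line
    where the functional is 1.\<close>
  have rescale: "\<exists>x. x \<in> interior A \<and> x \<notin> B \<and> Re (x * w) = 1"
    if AB: "(A, B) \<in> {(?C, ?D), (?D, ?C)}" and x: "x \<in> interior A" "x \<notin> B" for A B x
  proof -
    have A: "x \<in> A" using x interior_subset by blast
    have "x \<noteq> 0" using AB x wedge_zero_mem ang by auto
    then have r: "Re (x * w) > 0" using pos A AB by auto
    define r where "r = inverse (Re (x * w))"
    have "r > 0" using r by (simp add: r_def)
    have "(*\<^sub>R) r ` A \<subseteq> A" using AB wedge_scale \<open>r > 0\<close> by auto
    then have "r *\<^sub>R x \<in> interior A"
      using x(1) open_scaling[of r "interior A"] \<open>r > 0\<close> interior_subset[of A]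
        interior_maximal[of "(*\<^sub>R) r ` interior A" A] by blast
    moreover have "r *\<^sub>R x \<notin> B"
    proof
      assume "r *\<^sub>R x \<in> B"
      then have "inverse r *\<^sub>R (r *\<^sub>R x) \<in> B" using AB wedge_scale \<open>r > 0\<close>
        by (metis (no_types, lifting) Pair_inject empty_iff insertE inverse_positive_iff_positive)
      then show False using \<open>r > 0\<close> x by simp
    qed
    moreover have "Re ((r *\<^sub>R x) * w) = 1"
    proof -
      have "Re ((r *\<^sub>R x) * w) = r * Re (x * w)" by (simp add: algebra_simps)
      then show ?thesis using r by (simp add: r_def)
    qed
    ultimately show ?thesis by blast
  qed
  obtain x where x: "x \<in> interior ?C" "x \<notin> ?D" "Re (x * w) = 1"
  proof -
    obtain x where "x \<in> interior ?C" "x \<notin> ?D"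
      using interior_wedge_minus_closed[OF ang(1,2) closed_wedge[OF ang(3,4)] nsub(1)] .
    from rescale[OF _ this] show thesis using that by blast
  qed
  obtain y where y: "y \<in> interior ?D" "y \<notin> ?C" "Re (y * w) = 1"
  proof -
    obtain y where "y \<in> interior ?D" "y \<notin> ?C"
      using interior_wedge_minus_closed[OF ang(3,4) closed_wedge[OF ang(1,2)] nsub(2)] .
    from rescale[OF _ this] show thesis using that by blast
  qed
  have "x \<noteq> y" using x y interior_subset by blast
  \<comment> \<open>The functional is positive on both cones away from the apex, so the nonzero
    vectors \<open>x - y\<close> and \<open>y - x\<close>, on which it vanishes, lie in
    neither.\<close>
  moreover have "Re ((x - y) * w) = 0" "Re ((y - x) * w) = 0"
    using x(3) y(3) by (simp_all only: left_diff_distrib minus_complex.simps)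
  ultimately have "x - y \<notin> ?C \<union> ?D" "y - x \<notin> ?C \<union> ?D"
    using pos[of "x - y"] pos[of "y - x"] by auto
  then obtain S M where S: "finite S" "card S = ((k + l) choose k) - 1" and
    forces: "\<forall>c. \<exists>t. norm t \<le> M \<and>
       (monochromatic c Red k (S \<inter> (+) t ` ?C) \<or> monochromatic c Blue l (S \<inter> (+) t ` ?D))"
    using forcing_set_exists[of ?C ?D x y k l] x y ang wedge_scale
    by (auto simp: closed_wedge wedge_zero_mem)
  show ?thesis
  proof (intro exI[of _ S] conjI allI S)
    fix c
    obtain t where
      "monochromatic c Red k (S \<inter> (+) t ` ?C) \<or> monochromatic c Blue l (S \<inter> (+) t ` ?D)"
      using forces by blast
    then show "(\<exists>t. card {z \<in> S \<inter> (+) t ` V. c z = Red} = k \<and> {z \<in> S \<inter> (+) t ` V. c z = Blue} = {}) \<or>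
       (\<exists>t. card {z \<in> S \<inter> (+) t ` W. c z = Blue} = l \<and> {z \<in> S \<inter> (+) t ` W. c z = Red} = {})"
    proof (rule disj_forward)
    qed (erule monochromatic_translate_imp[OF V] monochromatic_translate_imp[OF W], simp)+
  qed
qed

end
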